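(* Any subgroup of index $p$ of $\mathcal{L}_n$ is isomorphic either to $\mathcal{L}_n$ or to $\mathcal{L}_{pn}$.
   Context: $p$ is a fixed prime, $n\ge 1$. For $k\ge 1$, $\mathcal{L}_k=(\mathbb{Z}/p\mathbb{Z})^k\wr\mathbb{Z}=\left(\bigoplus_{\mathbb{Z}}(\mathbb{Z}/p\mathbb{Z})^k\right)\rtimes\mathbb{Z}$, where the generator of $\mathbb{Z}$ acts by the shift by one. *)

theory Defs
  imports "HOL-Algebra.Product_Groups" "HOL-Computational_Algebra.Primes"
begin

definition semidirect_product ::
    "('a, 'c) monoid_scheme \<Rightarrow> ('b, 'd) monoid_scheme \<Rightarrow> ('b \<Rightarrow> 'a \<Rightarrow> 'a) \<Rightarrow> ('a \<times> 'b) monoid" where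
  "semidirect_product N Q \<alpha> =
    \<lparr>carrier = carrier N \<times> carrier Q,
     monoid.mult = (\<lambda>(x, s) (y, t). (x \<otimes>\<^bsub>N\<^esub> \<alpha> s y, s \<otimes>\<^bsub>Q\<^esub> t)),
     one = (\<one>\<^bsub>N\<^esub>, \<one>\<^bsub>Q\<^esub>)\<rparr>"

text \<open>Since the action is given by a plain function, the group law needs the hypotheses that it is
  an action by automorphisms (bijectivity follows from the action laws).\<close>

lemma group_semidirect_product:
  assumes N: "group N" and Q: "group Q"
    and hom: "\<And>s. s \<in> carrier Q \<Longrightarrow> \<alpha> s \<in> hom N N"
    and one: "\<And>x. x \<in> carrier N \<Longrightarrow> \<alpha> \<one>\<^bsub>Q\<^esub> x = x"
    and mult: "\<And>s t x. \<lbrakk>s \<in> carrier Q; t \<in> carrier Q; x \<in> carrier N\<rbrakk>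
      \<Longrightarrow> \<alpha> (s \<otimes>\<^bsub>Q\<^esub> t) x = \<alpha> s (\<alpha> t x)"
  shows "group (semidirect_product N Q \<alpha>)"
proof -
  interpret N: group N by (rule N)
  interpret Q: group Q by (rule Q)
  have closed: "\<alpha> s x \<in> carrier N" if "s \<in> carrier Q" "x \<in> carrier N" for s x
    using hom[OF that(1)] that(2) by (auto simp: hom_def)
  have distr: "\<alpha> s (x \<otimes>\<^bsub>N\<^esub> y) = \<alpha> s x \<otimes>\<^bsub>N\<^esub> \<alpha> s y"
    if "s \<in> carrier Q" "x \<in> carrier N" "y \<in> carrier N" for s x y
    using hom[OF that(1)] that(2,3) by (auto simp: hom_def)
  show ?thesis
  proof (rule groupI)
    fix z assume "z \<in> carrier (semidirect_product N Q \<alpha>)"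
    then obtain x s where z: "z = (x, s)" "x \<in> carrier N" "s \<in> carrier Q"
      by (auto simp: semidirect_product_def)
    let ?s = "inv\<^bsub>Q\<^esub> s"
    have "\<alpha> ?s (inv\<^bsub>N\<^esub> x) \<otimes>\<^bsub>N\<^esub> \<alpha> ?s x = \<alpha> ?s (inv\<^bsub>N\<^esub> x \<otimes>\<^bsub>N\<^esub> x)"
      using z by (simp only: distr Q.inv_closed N.inv_closed)
    also have "\<dots> = \<one>\<^bsub>N\<^esub>"
      using z hom_one[OF hom[of ?s] N N] by simp
    finally have "(\<alpha> ?s (inv\<^bsub>N\<^esub> x), ?s) \<otimes>\<^bsub>semidirect_product N Q \<alpha>\<^esub> z
        = \<one>\<^bsub>semidirect_product N Q \<alpha>\<^esub>"
      using z by (simp add: semidirect_product_def)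
    moreover have "(\<alpha> ?s (inv\<^bsub>N\<^esub> x), ?s) \<in> carrier (semidirect_product N Q \<alpha>)"
      using z by (simp add: semidirect_product_def closed)
    ultimately show "\<exists>y\<in>carrier (semidirect_product N Q \<alpha>).
        y \<otimes>\<^bsub>semidirect_product N Q \<alpha>\<^esub> z = \<one>\<^bsub>semidirect_product N Q \<alpha>\<^esub>"
      by blast
  qed (auto simp: semidirect_product_def closed distr one mult N.m_assoc Q.m_assoc)
qed

text \<open>\<open>lamplighter p k\<close> is the wreath product of \<open>(\<int>/p\<int>)\<^sup>k\<close> with \<open>\<int>\<close>. The library's
  \<open>sum_group\<close> is the direct sum (finitely supported families), and \<open>t\<close> in \<open>\<int>\<close> moves
  the lamp at position \<open>i\<close> to position \<open>i + t\<close>.\<close>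

definition lamp_group :: "nat \<Rightarrow> nat \<Rightarrow> (nat \<Rightarrow> int) monoid" where
  "lamp_group p k = product_group {..<k} (\<lambda>_. integer_mod_group p)"

definition shift :: "int \<Rightarrow> (int \<Rightarrow> 'a) \<Rightarrow> int \<Rightarrow> 'a" where
  "shift t f = (\<lambda>i. f (i - t))"

definition lamplighter :: "nat \<Rightarrow> nat \<Rightarrow> ((int \<Rightarrow> nat \<Rightarrow> int) \<times> int) monoid" where
  "lamplighter p k =
    semidirect_product (sum_group UNIV (\<lambda>_::int. lamp_group p k)) integer_group shift"

lemma group_lamp_group: "group (lamp_group p k)"
  by (simp add: lamp_group_def)

lemma group_lamplighter: "group (lamplighter p k)"
proof -
  let ?A = "lamp_group p k"
  have shift_closed: "shift t f \<in> carrier (sum_group UNIV (\<lambda>_::int. ?A))"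
    if "f \<in> carrier (sum_group UNIV (\<lambda>_::int. ?A))" for t f
  proof -
    have "{i. shift t f i \<noteq> \<one>\<^bsub>?A\<^esub>} = (\<lambda>i. i + t) ` {i. f i \<noteq> \<one>\<^bsub>?A\<^esub>}"
      by (force simp: shift_def image_iff intro: exI[of _ "_ - t"])
    then show ?thesis
      using that by (simp add: carrier_sum_group group_lamp_group) (auto simp: shift_def)
  qed
  show ?thesis
    unfolding lamplighter_def
    by (rule group_semidirect_product)
       (auto simp: hom_def group_lamp_group shift_closed, auto simp: shift_def algebra_simps)
qed

end

theory Submission
  imports Defs "HOL-Algebra.Multiplicative_Group"
begin

text \<open>Let \<open>V\<close> be the base group of \<open>\<L>\<^sub>n\<close>, viewed as the free module of rank \<open>n\<close> over the Laurent
  polynomials in \<open>x\<close> over \<open>\<int>/p\<int>\<close>, where \<open>x\<close> acts as the shift, and let \<open>W = H \<inter> V\<close>.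

  If \<open>W = V\<close>, then \<open>H\<close> is normal and, the quotient having order \<open>p\<close>, its image in \<open>\<int>\<close> is \<open>p\<int>\<close>.
  So \<open>H = V \<rtimes> p\<int>\<close>, and grouping \<open>p\<close> consecutive positions into one identifies it with \<open>\<L>\<^bsub>pn\<^esub>\<close>.

  Otherwise some \<open>x\<^sup>i e\<^sub>k\<close> lies outside \<open>W\<close>, and its multiples already represent all \<open>p\<close> cosets of \<open>H\<close>.
  Hence \<open>H\<close> contains some \<open>(v, 1)\<close>, \<open>W\<close> is a submodule, and \<open>V\<close> is the sum of \<open>W\<close> and \<open>\<langle>e\<^sub>k\<rangle>\<close>. Thus
  \<open>x e\<^sub>k - d\<^sub>k e\<^sub>k\<close> and \<open>e\<^sub>l - d\<^sub>l e\<^sub>k\<close> lie in \<open>W\<close> for suitable scalars \<open>d\<close>, and these \<open>n\<close> elements form a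
  basis of \<open>W\<close>. So \<open>W\<close> is isomorphic to \<open>V\<close> as a module, and \<open>H\<close> to \<open>\<L>\<^sub>n\<close>.\<close>

subsection \<open>Cosets of subgroups of prime index\<close>

text \<open>Bezout writes 1 as a combination of \<open>a\<close> and \<open>b\<close>. In the
  applications one of the exponents is \<open>p\<close>.\<close>

lemma (in group) mem_subgroup_of_coprime_pows:
  fixes a b :: int
  assumes H: "subgroup H G" and x: "x \<in> carrier G"
    and "x [^] a \<in> H" "x [^] b \<in> H" "coprime a b"
  shows "x \<in> H"
proof -
  obtain u v where uv: "u * a + v * b = 1"
    using bezout_int[of a b] \<open>coprime a b\<close> by (auto simp: coprime_iff_gcd_eq_1)
  have "(x [^] a) [^] u \<otimes> (x [^] b) [^] v \<in> H"
    by (intro subgroup.m_closed[OF H] subgroup_int_pow_closed[OF H] assms)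
  also have "(x [^] a) [^] u \<otimes> (x [^] b) [^] v = x [^] (u * a + v * b)"
    using x by (simp add: int_pow_pow int_pow_mult mult.commute)
  finally show ?thesis using x by (simp add: uv)
qed

text \<open>\<open>H\<close> may fail to be normal, so cosets are counted directly: two equal ones
  among \<open>H #> x [^] c\<close> with \<open>c < p\<close> would put a power of \<open>x\<close>
  with exponent prime to \<open>p\<close> into \<open>H\<close>, hence \<open>x\<close> itself.
  These \<open>p\<close> cosets are therefore all of them.\<close>

lemma (in group) pow_transversal_of_prime_index:
  assumes H: "subgroup H G" and p: "card (rcosets H) = p" "prime p"
    and x: "x \<in> carrier G" "x [^] p \<in> H" "x \<notin> H" and y: "y \<in> carrier G"
  shows "\<exists>c::nat. y \<otimes> inv (x [^] c) \<in> H"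
proof -
  let ?C = "\<lambda>c::nat. H #> x [^] c"
  have mem: "x [^] (int c - int d) \<in> H" if "?C c = ?C d" for c d
  proof -
    have "x [^] c \<in> H #> x [^] d"
      using rcos_self[of "x [^] c" H] that x H by simp
    then have "x [^] c \<otimes> inv (x [^] d) \<in> H"
      using subgroup.rcos_module[OF H] x is_group by simp
    also have "x [^] c \<otimes> inv (x [^] d) = x [^] (int c - int d)"
      using x by (simp add: int_pow_diff int_pow_int)
    finally show ?thesis .
  qed
  have inj: "inj_on ?C {..<p}"
  proof (rule inj_onI, rule ccontr)
    fix c d assume cd: "c \<in> {..<p}" "d \<in> {..<p}" "?C c = ?C d" "c \<noteq> d"
    have "\<not> int p dvd int c - int d"
      using cd zdvd_imp_le[of "int p" "\<bar>int c - int d\<bar>"] by auto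
    then have "coprime (int c - int d) (int p)"
      using p(2) prime_imp_coprime[of "int p"] by (metis coprime_commute prime_nat_int_transfer)
    moreover have "x [^] int p \<in> H" using x(2) by (simp add: int_pow_int)
    ultimately show False
      using mem_subgroup_of_coprime_pows[OF H x(1) mem[OF cd(3)]] x(3) by blast
  qed
  have "?C ` {..<p} = rcosets H"
  proof (rule card_subset_eq)
    \<comment> \<open>An infinite set would have cardinality 0, which is not prime.\<close>
    show "finite (rcosets H)" using p prime_gt_0_nat by (metis card.infinite less_irrefl)
    show "?C ` {..<p} \<subseteq> rcosets H"
      using x rcosetsI[OF subgroup.subset[OF H]] by auto
  qed (simp add: card_image inj p(1))
  moreover have "H #> y \<in> rcosets H" using y rcosetsI[OF subgroup.subset[OF H]] by auto
  ultimately obtain c where "H #> y = ?C c" by auto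
  then have "y \<in> ?C c" using rcos_self[OF y H] by simp
  then show ?thesis
    using subgroup.rcos_module[OF H] x y is_group by auto
qed

text \<open>Lagrange's theorem in the quotient \<open>G Mod H\<close>.\<close>

lemma (in group) pow_card_rcosets_mem_normal:
  assumes H: "H \<lhd> G" and x: "x \<in> carrier G"
  shows "x [^] card (rcosets H) \<in> H"
proof -
  interpret H: normal H G by (rule H)
  interpret Q: group "G Mod H" by (rule H.factorgroup_is_group)
  have hom: "(#>) H \<in> hom G (G Mod H)" by (rule H.r_coset_hom_Mod)
  have "H #> x [^] card (rcosets H) = (H #> x) [^]\<^bsub>G Mod H\<^esub> card (rcosets H)"
    by (rule hom_nat_pow[OF hom x is_group Q.is_group])
  also have "\<dots> = \<one>\<^bsub>G Mod H\<^esub>"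
    using Q.pow_order_eq_1[of "H #> x"] hom x by (auto simp: order_def FactGroup_def hom_def)
  finally have "H #> x [^] card (rcosets H) = H" by (simp add: FactGroup_def)
  then show ?thesis
    using coset_join1 H.subset H.is_subgroup x by (metis nat_pow_closed)
qed

subsection \<open>Lamp configurations\<close>

definition lamps :: "nat \<Rightarrow> nat \<Rightarrow> (int \<Rightarrow> nat \<Rightarrow> int) monoid" where
  "lamps p k = sum_group UNIV (\<lambda>_::int. lamp_group p k)"

text \<open>Elements of \<open>lamps p k\<close> are reduced modulo \<open>p\<close> and \<open>undefined\<close> at coordinates \<open>j \<ge> k\<close>;
  \<open>config\<close> normalises an arbitrary integer-valued function to this form, so that all computations can
  be done with integers.\<close>

definition config :: "nat \<Rightarrow> nat \<Rightarrow> (int \<Rightarrow> nat \<Rightarrow> int) \<Rightarrow> int \<Rightarrow> nat \<Rightarrow> int" where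
  "config p k F = (\<lambda>i. \<lambda>j\<in>{..<k}. F i j mod int p)"

lemma group_lamps: "group (lamps p k)"
  by (simp add: lamps_def group_lamp_group)

lemma lamplighter_eq: "lamplighter p k = semidirect_product (lamps p k) integer_group shift"
  by (simp add: lamplighter_def lamps_def)

lemma carrier_lamps:
  assumes "p > 0"
  shows "f \<in> carrier (lamps p k) \<longleftrightarrow>
    config p k f = f \<and> finite {i. \<exists>j<k. f i j \<noteq> 0}"
proof -
  have range: "x \<in> {0..<int p} \<longleftrightarrow> x mod int p = x" for x
    using assms pos_mod_sign[of "int p" x] pos_mod_bound[of "int p" x]
    by (metis atLeastLessThan_iff mod_pos_pos_trivial of_nat_0_less_iff)
  have pw: "f i \<in> (\<Pi>\<^sub>E j\<in>{..<k}. {0..<int p}) \<longleftrightarrow> config p k f i = f i" for i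
    unfolding PiE_iff range config_def fun_eq_iff extensional_def restrict_def
    by auto
  \<comment> \<open>Beyond \<open>k\<close> both sides are \<open>undefined\<close>, so only the
    first \<open>k\<close> coordinates decide whether \<open>f i\<close> is the identity.\<close>
  have one: "f i \<noteq> (\<lambda>j\<in>{..<k}. 0) \<longleftrightarrow> (\<exists>j<k. f i j \<noteq> 0)" if "config p k f = f" for i
  proof -
    have "f i j = undefined" if "\<not> j < k" for j
      using fun_cong[OF fun_cong[OF \<open>config p k f = f\<close>, of i], of j] that
      by (simp add: config_def)
    then show ?thesis by (auto simp: fun_eq_iff restrict_def)
  qed
  have "f \<in> carrier (lamps p k) \<longleftrightarrow>
      config p k f = f \<and> finite {i. f i \<noteq> (\<lambda>j\<in>{..<k}. 0)}"
    using assms pw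
    by (simp add: lamps_def carrier_sum_group group_lamp_group lamp_group_def PiE_iff[of f UNIV]
        carrier_integer_mod_group fun_eq_iff[of "config p k f"])
  then show ?thesis
    using one by (simp cong: conj_cong)
qed

lemma config_cong:
  "(\<And>i j. j < k \<Longrightarrow> F i j mod int p = G i j mod int p) \<Longrightarrow> config p k F = config p k G"
  by (auto simp: config_def fun_eq_iff restrict_def)

lemma config_in_lamps:
  assumes "p > 0" "finite {i. \<exists>j<k. F i j mod int p \<noteq> 0}"
  shows "config p k F \<in> carrier (lamps p k)"
proof -
  have "config p k (config p k F) = config p k F"
    by (rule config_cong) (simp add: config_def)
  moreover have "{i. \<exists>j<k. config p k F i j \<noteq> 0} = {i. \<exists>j<k. F i j mod int p \<noteq> 0}"
    by (simp add: config_def cong: conj_cong)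
  ultimately show ?thesis using assms by (simp only: carrier_lamps)
qed

lemma config_eq: "p > 0 \<Longrightarrow> f \<in> carrier (lamps p k) \<Longrightarrow> config p k f = f"
  by (simp add: carrier_lamps)

lemma mult_config:
  "config p k F \<otimes>\<^bsub>lamps p k\<^esub> config p k G = config p k (\<lambda>i j. F i j + G i j)"
  by (auto simp: lamps_def lamp_group_def config_def fun_eq_iff restrict_def mod_simps)

lemma one_lamps: "\<one>\<^bsub>lamps p k\<^esub> = config p k (\<lambda>i j. 0)"
  by (auto simp: lamps_def lamp_group_def config_def fun_eq_iff restrict_def)

lemma config_eq_iff:
  "config p k F = config p k G \<longleftrightarrow> (\<forall>i. \<forall>j<k. F i j mod int p = G i j mod int p)"
  by (auto simp: config_def fun_eq_iff restrict_def)

lemma shift_config: "shift t (config p k F) = config p k (\<lambda>i j. F (i - t) j)"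
  by (simp add: shift_def config_def)

lemma shift_in_lamps:
  assumes "p > 0" "f \<in> carrier (lamps p k)"
  shows "shift t f \<in> carrier (lamps p k)"
proof -
  have f: "config p k f = f" and fin: "finite {i. \<exists>j<k. f i j \<noteq> 0}"
    using carrier_lamps[OF assms(1), THEN iffD1, OF assms(2)] by (rule conjunct1, rule conjunct2)
  have "config p k (shift t f) = shift t (config p k f)"
    by (simp add: shift_def config_def)
  then have "config p k (shift t f) = shift t f"
    by (simp only: f)
  moreover have "finite {i. \<exists>j<k. shift t f i j \<noteq> 0}"
    using finite_vimageI[OF fin, of "\<lambda>i. i - t"] by (simp add: shift_def vimage_def inj_def)
  ultimately show ?thesis
    using assms(1) by (simp only: carrier_lamps simp_thms)
qed

lemma comm_group_lamps: "p > 0 \<Longrightarrow> comm_group (lamps p k)"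
proof (rule group.group_comm_groupI[OF group_lamps])
  fix f g assume "p > 0" "f \<in> carrier (lamps p k)" "g \<in> carrier (lamps p k)"
  then show "f \<otimes>\<^bsub>lamps p k\<^esub> g = g \<otimes>\<^bsub>lamps p k\<^esub> f"
    using mult_config[of p k f g] mult_config[of p k g f] by (simp add: config_eq add.commute)
qed

text \<open>\<open>lamp p k i j c\<close> is the Laurent monomial \<open>c x\<^sup>i e\<^sub>j\<close>.\<close>

definition lamp :: "nat \<Rightarrow> nat \<Rightarrow> int \<Rightarrow> nat \<Rightarrow> int \<Rightarrow> int \<Rightarrow> nat \<Rightarrow> int" where
  "lamp p k i j c = config p k (\<lambda>a b. if a = i \<and> b = j then c else 0)"

lemma lamp_in_lamps: "p > 0 \<Longrightarrow> lamp p k i j c \<in> carrier (lamps p k)"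
  unfolding lamp_def
  by (rule config_in_lamps) (auto intro!: finite_subset[where B = "{i}"] split: if_splits)

lemma lamp_mult: "lamp p k i j c \<otimes>\<^bsub>lamps p k\<^esub> lamp p k i j d = lamp p k i j (c + d)"
  unfolding lamp_def mult_config by (rule config_cong) simp

lemma shift_lamp: "shift t (lamp p k i j c) = lamp p k (i + t) j c"
  unfolding lamp_def shift_config by (rule config_cong) auto

lemma lamp_int_pow: "p > 0 \<Longrightarrow> lamp p k i j 1 [^]\<^bsub>lamps p k\<^esub> (c::int) = lamp p k i j c"
  using hom_int_pow[of "lamp p k i j" integer_group "lamps p k" 1 c]
  by (simp add: hom_def lamp_in_lamps lamp_mult group_lamps)

lemma inv_lamp: "p > 0 \<Longrightarrow> inv\<^bsub>lamps p k\<^esub> lamp p k i j c = lamp p k i j (- c)"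
  using group.int_pow_neg[OF group_lamps lamp_in_lamps, of p k i j 1 c]
  by (simp add: lamp_int_pow)

lemma lamp_eq_one: "int p dvd c \<Longrightarrow> lamp p k i j c = \<one>\<^bsub>lamps p k\<^esub>"
  unfolding lamp_def one_lamps by (rule config_cong) auto

text \<open>The monomials with coefficient 1 generate the base even as a monoid: each coefficient
  modulo \<open>p\<close> has a natural representative, and supports are finite.\<close>

lemma lamps_induct [consumes 2, case_names one mult lamp]:
  assumes p: "p > 0" and f: "f \<in> carrier (lamps p k)"
    and one: "P \<one>\<^bsub>lamps p k\<^esub>"
    and mult: "\<And>f g. \<lbrakk>f \<in> carrier (lamps p k); g \<in> carrier (lamps p k); P f; P g\<rbrakk>
      \<Longrightarrow> P (f \<otimes>\<^bsub>lamps p k\<^esub> g)"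
    and lamp: "\<And>i j. j < k \<Longrightarrow> P (lamp p k i j 1)"
  shows "P f"
proof -
  have nat: "P (lamp p k i j (int c))" if "j < k" for i j c
  proof (induction c)
    case 0
    then show ?case using one by (simp add: lamp_eq_one)
  next
    case (Suc c)
    then have "P (lamp p k i j 1 \<otimes>\<^bsub>lamps p k\<^esub> lamp p k i j (int c))"
      using that p by (intro mult lamp lamp_in_lamps)
    then show ?case by (simp add: lamp_mult)
  qed
  have lamp': "P (lamp p k i j c)" if "j < k" for i j c
  proof -
    have "lamp p k i j c = lamp p k i j (int (nat (c mod int p)))"
      unfolding lamp_def by (rule config_cong) (use p in auto)
    then show ?thesis by (rule ssubst) (rule nat[OF that])
  qed
  \<comment> \<open>Restrict \<open>f\<close> to a finite set \<open>A\<close> of lamps and add one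
    lamp at a time; membership in the carrier is carried along because \<open>mult\<close> asks for
    it.\<close>
  have conf: "config p k (\<lambda>i j. if (i, j) \<in> A then f i j else 0) \<in> carrier (lamps p k) \<and>
      P (config p k (\<lambda>i j. if (i, j) \<in> A then f i j else 0))"
    if "finite A" "A \<subseteq> UNIV \<times> {..<k}" for A
    using that
  proof (induction A)
    case empty
    then show ?case using one group.is_monoid[OF group_lamps, of p k]
      by (simp add: monoid.one_closed flip: one_lamps)
  next
    case (insert a A)
    obtain i j where a: "a = (i, j)" by fastforce
    have "config p k (\<lambda>i j. if (i, j) \<in> insert a A then f i j else 0)
        = lamp p k i j (f i j) \<otimes>\<^bsub>lamps p k\<^esub> config p k (\<lambda>i j. if (i, j) \<in> A then f i j else 0)"
      unfolding lamp_def mult_config by (rule config_cong) (use insert.hyps a in auto)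
    moreover have "j < k" using insert.prems a by auto
    ultimately show ?case
      using insert mult lamp' lamp_in_lamps[OF p] monoid.m_closed[OF group.is_monoid[OF group_lamps]]
      by auto
  qed
  let ?A = "{(i, j). j < k \<and> f i j \<noteq> 0}"
  have "?A \<subseteq> {i. \<exists>j<k. f i j \<noteq> 0} \<times> {..<k}" by auto
  then have "finite ?A"
    using f carrier_lamps[OF p, of f k] by (meson finite_SigmaI finite_lessThan finite_subset)
  then have "P (config p k (\<lambda>i j. if (i, j) \<in> ?A then f i j else 0))"
    by (rule conf[THEN conjunct2]) auto
  also have "config p k (\<lambda>i j. if (i, j) \<in> ?A then f i j else 0) = config p k f"
    by (rule config_cong) auto
  finally show ?thesis using config_eq[OF p f] by simp
qed

subsection \<open>Lamplighter groups as subgroups of lamplighter groups\<close>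

lemma carrier_lamplighter: "carrier (lamplighter p k) = carrier (lamps p k) \<times> UNIV"
  by (simp add: lamplighter_eq semidirect_product_def)

lemma mult_lamplighter:
  "(f, s) \<otimes>\<^bsub>lamplighter p k\<^esub> (g, t) = (f \<otimes>\<^bsub>lamps p k\<^esub> shift s g, s + t)"
  by (simp add: lamplighter_eq semidirect_product_def)

lemma one_lamplighter: "\<one>\<^bsub>lamplighter p k\<^esub> = (\<one>\<^bsub>lamps p k\<^esub>, 0)"
  by (simp add: lamplighter_eq semidirect_product_def)

lemma shift_0 [simp]: "shift 0 f = f"
  by (simp add: shift_def)

lemma snd_hom_lamplighter: "snd \<in> hom (lamplighter p k) integer_group"
  by (auto simp: hom_def mult_lamplighter carrier_lamplighter)

lemma snd_int_pow_lamplighter: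
  assumes "x \<in> carrier (lamplighter p k)"
  shows "snd (x [^]\<^bsub>lamplighter p k\<^esub> (t::int)) = t * snd x"
  using hom_int_pow[OF snd_hom_lamplighter assms group_lamplighter] by simp

lemma lamps_embedding_hom: "(\<lambda>f. (f, 0)) \<in> hom (lamps p k) (lamplighter p k)"
  by (simp add: hom_def carrier_lamplighter mult_lamplighter)

text \<open>The lamp component of \<open>x\<close> cancels because the base is commutative:
  conjugation on the base depends on \<open>snd x\<close> only.\<close>

lemma conj_lamplighter:
  assumes "p > 0" "x \<in> carrier (lamplighter p k)" "f \<in> carrier (lamps p k)"
  shows "x \<otimes>\<^bsub>lamplighter p k\<^esub> (f, 0) = (shift (snd x) f, 0) \<otimes>\<^bsub>lamplighter p k\<^esub> x"
  using assms
  by (cases x) (auto simp: mult_lamplighter carrier_lamplighter shift_in_lamps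
      comm_groupE(4)[OF comm_group_lamps])

text \<open>The isomorphism sends \<open>(f, t)\<close> to \<open>(\<psi> f, 0)\<close> times the
  \<open>t\<close>-th power of \<open>h = (v, m)\<close>. Conjugation by \<open>h\<close> shifts the
  base by \<open>m\<close>, whatever \<open>v\<close> is, so equivariance of \<open>\<psi>\<close>
  makes this a homomorphism. The cases used are \<open>m = p\<close> with \<open>regroup\<close> and
  \<open>m = 1\<close> with \<open>twist\<close>.\<close>

lemma iso_lamplighter_of_equivariant:
  assumes p: "p > 0" and H: "subgroup H (lamplighter p n)"
    and hom: "\<psi> \<in> hom (lamps p k) (lamps p n)" and inj: "inj_on \<psi> (carrier (lamps p k))"
    and equivariant: "\<And>t f. f \<in> carrier (lamps p k) \<Longrightarrow> \<psi> (shift t f) = shift (m * t) (\<psi> f)"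
    and m: "m \<noteq> 0" and h: "(v, m) \<in> H"
    and base: "{f \<in> carrier (lamps p n). (f, 0) \<in> H} = \<psi> ` carrier (lamps p k)"
    and dvd: "\<And>f t. (f, t) \<in> H \<Longrightarrow> m dvd t"
  shows "(lamplighter p n)\<lparr>carrier := H\<rparr> \<cong> lamplighter p k"
proof -
  let ?L = "lamplighter p n" and ?M = "lamplighter p k"
  interpret L: group ?L by (rule group_lamplighter)
  define h where "h = (v, m)"
  define F where "F = (\<lambda>(f, t::int). (\<psi> f, 0) \<otimes>\<^bsub>?L\<^esub> h [^]\<^bsub>?L\<^esub> t)"
  have hH: "h \<in> H" using h by (simp add: h_def)
  have hL: "h \<in> carrier ?L" using hH subgroup.subset[OF H] by auto
  have snd_h: "snd (h [^]\<^bsub>?L\<^esub> t) = m * t" for t :: int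
    using snd_int_pow_lamplighter[OF hL] by (simp add: h_def mult.commute)
  have hp: "h [^]\<^bsub>?L\<^esub> (t::int) \<in> H" for t
    by (rule L.subgroup_int_pow_closed[OF H hH])
  have psi_in: "\<psi> f \<in> carrier (lamps p n)" if "f \<in> carrier (lamps p k)" for f
    using hom that by (auto simp: hom_def)
  have psiL: "(\<psi> f, 0) \<in> carrier ?L" if "f \<in> carrier (lamps p k)" for f
    using psi_in that by (simp add: carrier_lamplighter)
  have psiH: "(\<psi> f, 0) \<in> H" if "f \<in> carrier (lamps p k)" for f
    using base that by blast
  have FH: "F x \<in> H" if "x \<in> carrier ?M" for x
    using that
    by (auto simp: F_def carrier_lamplighter simp del: split_paired_All
        intro!: subgroup.m_closed[OF H psiH hp])
  have snd_F: "snd (F (f, t)) = m * t" for f t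
    by (cases "h [^]\<^bsub>?L\<^esub> t") (use snd_h[of t] in \<open>simp add: F_def mult_lamplighter\<close>)
  have "F \<in> iso ?M (?L\<lparr>carrier := H\<rparr>)"
  proof (rule isoI)
    show "F \<in> hom ?M (?L\<lparr>carrier := H\<rparr>)"
    proof (rule homI)
      fix x y assume xy: "x \<in> carrier ?M" "y \<in> carrier ?M"
      obtain f s g t where x: "x = (f, s)" and y: "y = (g, t)" by fastforce
      have f: "f \<in> carrier (lamps p k)" and g: "g \<in> carrier (lamps p k)"
        using xy x y by (auto simp: carrier_lamplighter)
      have sg: "shift s g \<in> carrier (lamps p k)" using shift_in_lamps[OF p g] .
      have L1: "(\<psi> f, 0) \<in> carrier ?L" "(\<psi> g, 0) \<in> carrier ?L" "(\<psi> (shift s g), 0) \<in> carrier ?L"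
        using psiL f g sg by auto
      have hL': "h [^]\<^bsub>?L\<^esub> (t::int) \<in> carrier ?L" for t using hL by simp
      have "F (x \<otimes>\<^bsub>?M\<^esub> y) = (\<psi> (f \<otimes>\<^bsub>lamps p k\<^esub> shift s g), 0) \<otimes>\<^bsub>?L\<^esub> h [^]\<^bsub>?L\<^esub> (s + t)"
        by (simp add: x y F_def mult_lamplighter)
      also have "(\<psi> (f \<otimes>\<^bsub>lamps p k\<^esub> shift s g), 0) = (\<psi> f, 0) \<otimes>\<^bsub>?L\<^esub> (\<psi> (shift s g), 0::int)"
        using hom_mult[OF hom f sg] by (simp add: mult_lamplighter)
      also have "\<dots> \<otimes>\<^bsub>?L\<^esub> h [^]\<^bsub>?L\<^esub> (s + t)
          = (\<psi> f, 0) \<otimes>\<^bsub>?L\<^esub> (((\<psi> (shift s g), 0) \<otimes>\<^bsub>?L\<^esub> h [^]\<^bsub>?L\<^esub> s) \<otimes>\<^bsub>?L\<^esub> h [^]\<^bsub>?L\<^esub> t)"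
        using L1 hL' hL by (simp add: L.int_pow_mult L.m_assoc)
      also have "(\<psi> (shift s g), 0) \<otimes>\<^bsub>?L\<^esub> h [^]\<^bsub>?L\<^esub> s = h [^]\<^bsub>?L\<^esub> s \<otimes>\<^bsub>?L\<^esub> (\<psi> g, 0)"
        using conj_lamplighter[OF p hL' psi_in[OF g], of s] equivariant[OF g, of s] snd_h[of s] by simp
      also have "(\<psi> f, 0) \<otimes>\<^bsub>?L\<^esub> ((h [^]\<^bsub>?L\<^esub> s \<otimes>\<^bsub>?L\<^esub> (\<psi> g, 0)) \<otimes>\<^bsub>?L\<^esub> h [^]\<^bsub>?L\<^esub> t) = F x \<otimes>\<^bsub>?L\<^esub> F y"
        using L1 hL' by (simp add: x y F_def L.m_assoc)
      finally show "F (x \<otimes>\<^bsub>?M\<^esub> y) = F x \<otimes>\<^bsub>?L\<lparr>carrier := H\<rparr>\<^esub> F y" by simp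
    qed (simp add: FH)
    have "inj_on F (carrier ?M)"
    proof (rule inj_onI)
      fix x y assume xy: "x \<in> carrier ?M" "y \<in> carrier ?M" "F x = F y"
      obtain f s g t where x: "x = (f, s)" and y: "y = (g, t)" by fastforce
      have st: "s = t" using snd_F[of f s] snd_F[of g t] xy(3) m by (simp add: x y)
      have f: "f \<in> carrier (lamps p k)" and g: "g \<in> carrier (lamps p k)"
        using xy x y by (auto simp: carrier_lamplighter)
      have "(\<psi> f, 0::int) = (\<psi> g, 0)"
        using xy(3) L.right_cancel[of "h [^]\<^bsub>?L\<^esub> t" "(\<psi> f, 0)" "(\<psi> g, 0)"] psiL[OF f] psiL[OF g] hL
        by (simp add: x y F_def st)
      then show "x = y" using inj f g by (simp add: x y st inj_on_eq_iff)
    qed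
    moreover have "F ` carrier ?M = H"
    proof
      show "H \<subseteq> F ` carrier ?M"
      proof
        fix x assume x: "x \<in> H"
        then have xL: "x \<in> carrier ?L" using subgroup.subset[OF H] by auto
        \<comment> \<open>Divisibility by \<open>m\<close> lets a power of \<open>h\<close> remove
          the integer component of \<open>x\<close>; what remains lies in the base part of
          \<open>H\<close>, the image of \<open>\<psi>\<close>.\<close>
        obtain t where t: "snd x = m * t" using dvd[of "fst x" "snd x"] x by (auto elim: dvdE)
        define y where "y = x \<otimes>\<^bsub>?L\<^esub> h [^]\<^bsub>?L\<^esub> (- t)"
        have yH: "y \<in> H" unfolding y_def by (intro subgroup.m_closed[OF H] x hp)
        have "snd y = 0"
          using hom_mult[OF snd_hom_lamplighter xL L.int_pow_closed[OF hL, of "- t"]] snd_h[of "- t"] t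
          by (simp add: y_def)
        moreover have "fst y \<in> carrier (lamps p n)"
          using yH subgroup.subset[OF H] by (auto simp: carrier_lamplighter)
        ultimately obtain f where f: "f \<in> carrier (lamps p k)" "y = (\<psi> f, 0)"
          using base yH by (cases y) force
        have "x = y \<otimes>\<^bsub>?L\<^esub> h [^]\<^bsub>?L\<^esub> t"
          using xL hL by (simp add: y_def L.m_assoc flip: L.int_pow_mult)
        then show "x \<in> F ` carrier ?M"
          using f by (auto simp: F_def carrier_lamplighter intro!: image_eqI[of _ _ "(f, t)"])
      qed
    qed (use FH in auto)
    ultimately show "bij_betw F (carrier ?M) (carrier (?L\<lparr>carrier := H\<rparr>))"
      by (simp add: bij_betw_def)
  qed
  then show ?thesis
    using group.iso_sym[OF group_lamplighter] by (auto simp: is_iso_def)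
qed

subsection \<open>Shift-invariant subgroups of index \<open>p\<close> in the base\<close>

text \<open>With \<open>e\<^sub>0, \<dots>, e\<^bsub>n-1\<^esub>\<close> the standard basis, \<open>twist\<close> is the linear map over the Laurent
  polynomials sending \<open>e\<^sub>k\<close> to \<open>(x - d k) e\<^sub>k\<close> and \<open>e\<^sub>l\<close> to \<open>e\<^sub>l - d l e\<^sub>k\<close> for \<open>l \<noteq> k\<close>.\<close>

definition twist :: "nat \<Rightarrow> nat \<Rightarrow> nat \<Rightarrow> (nat \<Rightarrow> int) \<Rightarrow> (int \<Rightarrow> nat \<Rightarrow> int) \<Rightarrow> int \<Rightarrow> nat \<Rightarrow> int" where
  "twist p n k d f =
    config p n (\<lambda>i j. if j = k then f (i - 1) k - (\<Sum>l<n. d l * f i l) else f i j)"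

lemma twist_config:
  assumes "k < n"
  shows "twist p n k d (config p n F) = twist p n k d F"
  unfolding twist_def
proof (rule config_cong)
  fix i j assume "j < n"
  have "(\<Sum>l<n. d l * (F i l mod int p)) mod int p = (\<Sum>l<n. d l * F i l) mod int p"
    by (subst (1 2) mod_sum_eq[symmetric]) (simp add: mod_mult_right_eq)
  then have "(F (i - 1) k mod int p - (\<Sum>l<n. d l * (F i l mod int p))) mod int p
      = (F (i - 1) k - (\<Sum>l<n. d l * F i l)) mod int p"
    by (metis mod_diff_cong mod_mod_trivial)
  then show "(if j = k then config p n F (i - 1) k - (\<Sum>l<n. d l * config p n F i l)
        else config p n F i j) mod int p
      = (if j = k then F (i - 1) k - (\<Sum>l<n. d l * F i l) else F i j) mod int p"
    using \<open>k < n\<close> \<open>j < n\<close> by (simp add: config_def)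
qed

lemma twist_in_lamps:
  assumes p: "p > 0" and k: "k < n" and f: "f \<in> carrier (lamps p n)"
  shows "twist p n k d f \<in> carrier (lamps p n)"
  unfolding twist_def
proof (rule config_in_lamps[OF p], rule finite_subset)
  let ?S = "{i. \<exists>j<n. f i j \<noteq> 0}"
  \<comment> \<open>The term \<open>f (i - 1) k\<close> moves the support one position to the
    right.\<close>
  show "finite (?S \<union> (\<lambda>i. i + 1) ` ?S)"
    using f carrier_lamps[OF p, of f n] by blast
  show "{i. \<exists>j<n. (if j = k then f (i - 1) k - (\<Sum>l<n. d l * f i l) else f i j) mod int p \<noteq> 0}
      \<subseteq> ?S \<union> (\<lambda>i. i + 1) ` ?S"
  proof
    fix i
    assume "i \<in> {i. \<exists>j<n. (if j = k then f (i - 1) k - (\<Sum>l<n. d l * f i l) else f i j)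
      mod int p \<noteq> 0}"
    moreover have "(\<Sum>l<n. d l * f i l) = 0" if "i \<notin> ?S" using that by simp
    ultimately have "i \<in> ?S \<or> f (i - 1) k \<noteq> 0" by (auto split: if_splits)
    then show "i \<in> ?S \<union> (\<lambda>i. i + 1) ` ?S"
      using k by (auto intro!: image_eqI[of i _ "i - 1"])
  qed
qed

lemma twist_hom:
  assumes p: "p > 0" and k: "k < n"
  shows "twist p n k d \<in> hom (lamps p n) (lamps p n)"
proof (rule homI)
  fix f g assume "f \<in> carrier (lamps p n)" "g \<in> carrier (lamps p n)"
  then have "f \<otimes>\<^bsub>lamps p n\<^esub> g = config p n (\<lambda>i j. f i j + g i j)"
    using mult_config[of p n f g] p by (simp add: config_eq)
  then have "twist p n k d (f \<otimes>\<^bsub>lamps p n\<^esub> g) = twist p n k d (\<lambda>i j. f i j + g i j)"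
    by (simp add: twist_config[OF k])
  also have "\<dots> = twist p n k d f \<otimes>\<^bsub>lamps p n\<^esub> twist p n k d g"
    unfolding twist_def mult_config
    by (rule config_cong) (simp add: sum.distrib algebra_simps)
  finally show "twist p n k d (f \<otimes>\<^bsub>lamps p n\<^esub> g) = twist p n k d f \<otimes>\<^bsub>lamps p n\<^esub> twist p n k d g" .
qed (rule twist_in_lamps[OF p k])

lemma twist_shift: "twist p n k d (shift t f) = shift t (twist p n k d f)"
  unfolding twist_def shift_config by (rule config_cong) (simp add: shift_def algebra_simps)

lemma twist_lamp:
  assumes "l < n" "k < n"
  shows "twist p n k d (lamp p n i l c) =
    (if l = k then lamp p n (i + 1) k c else lamp p n i l c) \<otimes>\<^bsub>lamps p n\<^esub> lamp p n i k (- d l * c)"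
proof -
  have "(\<Sum>b<n. d b * (if a = i \<and> b = l then c else 0)) = (if a = i then d l * c else 0)" for a
  proof -
    have "(\<Sum>b<n. d b * (if a = i \<and> b = l then c else 0))
        = (\<Sum>b<n. if b = l then (if a = i then d l * c else 0) else 0)"
      by (rule sum.cong) auto
    then show ?thesis using assms(1) by simp
  qed
  note S = this
  have "twist p n k d (lamp p n i l c) =
      config p n (\<lambda>a b. if b = k then (if a - 1 = i \<and> k = l then c else 0) - (if a = i then d l * c else 0)
        else if a = i \<and> b = l then c else 0)"
    unfolding lamp_def twist_config[OF assms(2)] unfolding twist_def S ..
  also have "\<dots> = (if l = k then lamp p n (i + 1) k c else lamp p n i l c) \<otimes>\<^bsub>lamps p n\<^esub> lamp p n i k (- d l * c)"
  proof (cases "l = k")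
    case True
    show ?thesis
      unfolding True lamp_def mult_config simp_thms if_True by (rule config_cong) auto
  next
    case False
    then have F: "(if l = k then x else y) = y" for x y :: "int \<Rightarrow> nat \<Rightarrow> int" by simp
    show ?thesis
      unfolding F lamp_def mult_config by (rule config_cong) (use False in auto)
  qed
  finally show ?thesis .
qed

text \<open>Coordinates other than \<open>k\<close> are left unchanged, so a kernel element is a
  multiple of \<open>e_k\<close>, and multiplication by \<open>x - d k\<close> is injective on
  Laurent polynomials.\<close>

lemma twist_inj:
  assumes p: "p > 0" and k: "k < n"
  shows "inj_on (twist p n k d) (carrier (lamps p n))"
proof -
  interpret group_hom "lamps p n" "lamps p n" "twist p n k d"
    by (simp add: group_hom_def group_hom_axioms_def group_lamps twist_hom[OF p k])
  show ?thesis
    unfolding inj_on_one_iff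
  proof (intro allI impI)
    fix f assume f: "f \<in> carrier (lamps p n)" and 1: "twist p n k d f = \<one>\<^bsub>lamps p n\<^esub>"
    have red: "f i j mod int p = f i j" if "j < n" for i j
      using fun_cong[OF fun_cong[OF config_eq[OF p f]], of i j] that by (simp add: config_def)
    have E: "(if j = k then f (i - 1) k - (\<Sum>l<n. d l * f i l) else f i j) mod int p = 0"
      if "j < n" for i j
      using 1 that unfolding twist_def one_lamps config_eq_iff by auto
    have other: "f i j = 0" if "j < n" "j \<noteq> k" for i j
      using E[of j i] red[of j i] that by simp
    have "f i k = 0" for i
    proof (rule ccontr)
      let ?S = "{i. f i k \<noteq> 0}"
      assume "f i k \<noteq> 0"
      then have ne: "?S \<noteq> {}" by auto
      have "?S \<subseteq> {i. \<exists>j<n. f i j \<noteq> 0}" using k by auto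
      then have fin: "finite ?S"
        using f carrier_lamps[OF p, of f n] finite_subset by blast
      define a where "a = Max ?S" \<comment> \<open>the leading term of \<open>(x - d k) f\<^sub>k\<close> sits at \<open>a + 1\<close>\<close>
      have "f a k \<noteq> 0" using Max_in[OF fin ne] by (simp add: a_def)
      have "f (a + 1) k = 0"
        using Max_ge[OF fin, of "a + 1"] by (auto simp: a_def)
      then have "f (a + 1) l = 0" if "l < n" for l using other that by metis
      then have "f a k mod int p = 0" using E[OF k, of "a + 1"] by simp
      then show False using \<open>f a k \<noteq> 0\<close> red[OF k] by simp
    qed
    with other have "config p n f = config p n (\<lambda>i j. 0)"
      by (intro config_cong) metis
    then show "f = \<one>\<^bsub>lamps p n\<^esub>" using config_eq[OF p f] by (simp add: one_lamps)
  qed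
qed

text \<open>The image is generated as a module by the elements in the assumption on
  \<open>d\<close>, hence lies in \<open>W\<close>. Conversely, the image and the scalar multiples
  of \<open>e_k\<close> span the base, so an element of \<open>W\<close> differs from one of the
  image by some \<open>c e_k\<close> in \<open>W\<close>, and this forces \<open>c\<close> to vanish
  modulo \<open>p\<close>.\<close>

lemma image_twist:
  assumes p: "Factorial_Ring.prime p" and k: "k < n" and W: "subgroup W (lamps p n)"
    and shift: "\<And>t f. f \<in> W \<Longrightarrow> shift t f \<in> W" and notin: "lamp p n 0 k 1 \<notin> W"
    and d: "\<And>l. l < n \<Longrightarrow>
      (if l = k then lamp p n 1 k 1 else lamp p n 0 l 1) \<otimes>\<^bsub>lamps p n\<^esub> lamp p n 0 k (- d l) \<in> W"
  shows "twist p n k d ` carrier (lamps p n) = W"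
proof
  let ?V = "lamps p n" and ?\<psi> = "twist p n k d"
  have p0: "p > 0" using p prime_gt_0_nat by simp
  interpret V: comm_group ?V using comm_group_lamps[OF p0] .
  interpret psi: group_hom ?V ?V ?\<psi>
    by (simp add: group_hom_def group_hom_axioms_def group_lamps twist_hom[OF p0 k])
  have L: "lamp p n i j c \<in> carrier ?V" for i j c by (rule lamp_in_lamps[OF p0])
  show sub: "?\<psi> ` carrier ?V \<subseteq> W"
  proof
    have "?\<psi> f \<in> W" if "f \<in> carrier ?V" for f
      using p0 that
    proof (induction rule: lamps_induct)
      case (lamp i j)
      have "?\<psi> (lamp p n i j 1) = shift i (?\<psi> (lamp p n 0 j 1))"
        by (simp add: shift_lamp flip: twist_shift)
      moreover have "?\<psi> (lamp p n 0 j 1) \<in> W"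
        using d[OF lamp] unfolding twist_lamp[OF lamp k] by (simp split: if_splits)
      ultimately show ?case using shift by simp
    qed (use W in \<open>simp_all add: subgroup.one_closed subgroup.m_closed\<close>)
    then show "x \<in> W" if "x \<in> ?\<psi> ` carrier ?V" for x using that by auto
  qed
  have dvd: "int p dvd c" if "lamp p n 0 k c \<in> W" for c
  proof (rule ccontr)
    assume "\<not> int p dvd c"
    then have "coprime c (int p)"
      using p prime_imp_coprime[of "int p" c] by (metis coprime_commute prime_nat_int_transfer)
    moreover have "lamp p n 0 k (int p) \<in> W" using W by (simp add: lamp_eq_one subgroup.one_closed)
    ultimately show False
      using V.mem_subgroup_of_coprime_pows[OF W L, of 0 k 1 c "int p"] that notin
      by (simp add: lamp_int_pow[OF p0])
  qed
  \<comment> \<open>Otherwise \<open>x e_k\<close> would lie in \<open>W\<close>, and after shifting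
    back so would \<open>e_k\<close>.\<close>
  have "\<not> int p dvd d k"
  proof
    assume "int p dvd d k"
    then have "lamp p n 1 k 1 \<in> W" using d[OF k] L by (simp add: lamp_eq_one)
    then show False using shift[of "lamp p n 1 k 1" "-1"] notin by (simp add: shift_lamp)
  qed
  then have "coprime (d k) (int p)"
    using p prime_imp_coprime[of "int p" "d k"] by (metis coprime_commute prime_nat_int_transfer)
  then obtain b q where bq: "b * d k + q * int p = 1"
    using bezout_int[of "d k" "int p"] by (auto simp: coprime_iff_gcd_eq_1)
  \<comment> \<open>The image of \<open>twist\<close> together with \<open>e\<^sub>k\<close> spans everything, because \<open>x\<close> acts on \<open>e\<^sub>k\<close> modulo
    the image as the unit \<open>d k\<close>.\<close>
  define S where "S f \<longleftrightarrow> (\<exists>g\<in>carrier ?V. \<exists>c. f = ?\<psi> g \<otimes>\<^bsub>?V\<^esub> lamp p n 0 k c)" for f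
  have S_mult: "S (f \<otimes>\<^bsub>?V\<^esub> g)" if "S f" "S g" for f g
  proof -
    obtain f' c g' c' where f': "f' \<in> carrier ?V" "f = ?\<psi> f' \<otimes>\<^bsub>?V\<^esub> lamp p n 0 k c"
      and g': "g' \<in> carrier ?V" "g = ?\<psi> g' \<otimes>\<^bsub>?V\<^esub> lamp p n 0 k c'"
      using \<open>S f\<close> \<open>S g\<close> unfolding S_def by blast
    have "f \<otimes>\<^bsub>?V\<^esub> g = (?\<psi> f' \<otimes>\<^bsub>?V\<^esub> ?\<psi> g') \<otimes>\<^bsub>?V\<^esub> (lamp p n 0 k c \<otimes>\<^bsub>?V\<^esub> lamp p n 0 k c')"
      using f' g' L by (simp add: V.m_ac)
    also have "\<dots> = ?\<psi> (f' \<otimes>\<^bsub>?V\<^esub> g') \<otimes>\<^bsub>?V\<^esub> lamp p n 0 k (c + c')"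
      using f' g' by (simp add: lamp_mult)
    finally show ?thesis unfolding S_def using f' g' by blast
  qed
  have S_psi: "S (?\<psi> g)" if "g \<in> carrier ?V" for g
    unfolding S_def using that
    by (intro bexI[of _ g] exI[of _ 0]) (simp_all add: lamp_eq_one)
  have S_lamp_k: "S (lamp p n i k c)" for i c
  proof (induction i arbitrary: c rule: int_induct[where k = 0])
    case base
    show ?case unfolding S_def
      by (intro bexI[of _ "\<one>\<^bsub>?V\<^esub>"] exI[of _ c]) (simp_all add: L)
  next
    case (step1 i)
    have "lamp p n (i + 1) k c = ?\<psi> (lamp p n i k c) \<otimes>\<^bsub>?V\<^esub> lamp p n i k (d k * c)"
      using L by (simp add: twist_lamp[OF k k] V.m_assoc lamp_mult lamp_eq_one)
    then show ?case using S_mult[OF S_psi[OF L] step1.IH] by simp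
  next
    case (step2 i)
    \<comment> \<open>Going one position down means inverting \<open>x\<close> modulo the image:
      \<open>b\<close> is the inverse of \<open>d k\<close> modulo \<open>p\<close>.\<close>
    have "?\<psi> (lamp p n (i - 1) k (- b * c)) = lamp p n i k (- b * c) \<otimes>\<^bsub>?V\<^esub> lamp p n (i - 1) k (d k * b * c)"
      by (simp add: twist_lamp[OF k k] algebra_simps)
    also have "lamp p n (i - 1) k (d k * b * c) = lamp p n (i - 1) k c"
    proof -
      have "c = d k * b * c + int p * (q * c)"
        using arg_cong[OF bq, of "\<lambda>x. x * c"] by (simp add: algebra_simps)
      then have "d k * b * c mod int p = c mod int p" by (metis mod_mult_self2)
      then show ?thesis unfolding lamp_def by (intro config_cong) simp
    qed
    finally have "lamp p n (i - 1) k c = ?\<psi> (lamp p n (i - 1) k (- b * c)) \<otimes>\<^bsub>?V\<^esub> lamp p n i k (b * c)"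
      using L
      by (simp add: V.m_comm[of "lamp p n i k (- (b * c))"] V.m_assoc lamp_mult lamp_eq_one)
    then show ?case using S_mult[OF S_psi[OF L] step2.IH] by simp
  qed
  show "W \<subseteq> ?\<psi> ` carrier ?V"
  proof
    fix f assume f: "f \<in> W"
    then have "f \<in> carrier ?V" using subgroup.subset[OF W] by auto
    with p0 have "S f"
    proof (induction rule: lamps_induct)
      case one
      then show ?case using S_psi[of "\<one>\<^bsub>?V\<^esub>"] by simp
    next
      case (lamp i j)
      show ?case
      proof (cases "j = k")
        case False
        then have "lamp p n i j 1 = ?\<psi> (lamp p n i j 1) \<otimes>\<^bsub>?V\<^esub> lamp p n i k (d j)"
          using L by (simp add: twist_lamp[OF lamp k] V.m_assoc lamp_mult lamp_eq_one)
        then show ?thesis by (rule ssubst) (rule S_mult[OF S_psi[OF L] S_lamp_k])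
      qed (simp add: S_lamp_k)
    qed (rule S_mult)
    then obtain g c where g: "g \<in> carrier ?V" "f = ?\<psi> g \<otimes>\<^bsub>?V\<^esub> lamp p n 0 k c"
      unfolding S_def by blast
    have "?\<psi> g \<in> W" using sub g by auto
    moreover have "lamp p n 0 k c = inv\<^bsub>?V\<^esub> (?\<psi> g) \<otimes>\<^bsub>?V\<^esub> f"
      using g L by (simp flip: V.m_assoc)
    ultimately have "lamp p n 0 k c \<in> W"
      using f by (simp add: subgroup.m_closed[OF W] subgroup.m_inv_closed[OF W])
    then have "lamp p n 0 k c = \<one>\<^bsub>?V\<^esub>" by (intro lamp_eq_one dvd)
    then have "f = ?\<psi> g" using g by simp
    then show "f \<in> ?\<psi> ` carrier ?V" using g by auto
  qed
qed

subsection \<open>Grouping positions\<close>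

text \<open>\<open>regroup\<close> identifies the lamp \<open>r * n + j\<close> at position \<open>q\<close> with the lamp \<open>j\<close> at position \<open>p * q + r\<close>,
  for \<open>r < p\<close> and \<open>j < n\<close>.\<close>

definition regroup :: "nat \<Rightarrow> nat \<Rightarrow> (int \<Rightarrow> nat \<Rightarrow> int) \<Rightarrow> int \<Rightarrow> nat \<Rightarrow> int" where
  "regroup p n f = config p n (\<lambda>i j. f (i div int p) (j + n * nat (i mod int p)))"

lemma regroup_index:
  assumes "p > 0" "j < n"
  shows "j + n * nat (i mod int p) < p * n"
proof -
  have "nat (i mod int p) < p" using assms by (simp add: nat_less_iff)
  then have "n * (nat (i mod int p) + 1) \<le> n * p" by (intro mult_le_mono2) simp
  then show ?thesis using assms by (simp add: algebra_simps)
qed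

lemma regroup_config:
  assumes "p > 0"
  shows "regroup p n (config p (p * n) F) = regroup p n F"
  unfolding regroup_def
  by (rule config_cong) (simp add: config_def regroup_index[OF assms])

lemma regroup_hom:
  assumes p: "p > 0"
  shows "regroup p n \<in> hom (lamps p (p * n)) (lamps p n)"
proof (rule homI)
  fix f assume f: "f \<in> carrier (lamps p (p * n))"
  let ?S = "{i. \<exists>j<p * n. f i j \<noteq> 0}"
  show "regroup p n f \<in> carrier (lamps p n)"
    unfolding regroup_def
  proof (rule config_in_lamps[OF p], rule finite_subset)
    \<comment> \<open>The coarse position \<open>a\<close> covers the fine positions
      \<open>p * a\<close> to \<open>p * a + p - 1\<close>.\<close>
    show "finite ((\<lambda>(a, r). int p * a + r) ` (?S \<times> {0..<int p}))"
      using f carrier_lamps[OF p, of f "p * n"] by blast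
    show "{i. \<exists>j<n. f (i div int p) (j + n * nat (i mod int p)) mod int p \<noteq> 0}
        \<subseteq> (\<lambda>(a, r). int p * a + r) ` (?S \<times> {0..<int p})"
    proof
      fix i assume "i \<in> {i. \<exists>j<n. f (i div int p) (j + n * nat (i mod int p)) mod int p \<noteq> 0}"
      then obtain j where "j < n" "f (i div int p) (j + n * nat (i mod int p)) \<noteq> 0" by force
      then have "i div int p \<in> ?S" using regroup_index[OF p] by blast
      then show "i \<in> (\<lambda>(a, r). int p * a + r) ` (?S \<times> {0..<int p})"
        using p by (intro image_eqI[of i _ "(i div int p, i mod int p)"]) auto
    qed
  qed
next
  fix f g assume "f \<in> carrier (lamps p (p * n))" "g \<in> carrier (lamps p (p * n))"
  then have "f \<otimes>\<^bsub>lamps p (p * n)\<^esub> g = config p (p * n) (\<lambda>i j. f i j + g i j)"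
    using mult_config[of p "p * n" f g] p by (simp add: config_eq)
  then show "regroup p n (f \<otimes>\<^bsub>lamps p (p * n)\<^esub> g) = regroup p n f \<otimes>\<^bsub>lamps p n\<^esub> regroup p n g"
    by (simp add: regroup_config[OF p]) (simp add: regroup_def mult_config)
qed

lemma regroup_shift:
  assumes "p > 0"
  shows "regroup p n (shift t f) = shift (int p * t) (regroup p n f)"
proof -
  have "(i - int p * t) div int p = i div int p - t" "(i - int p * t) mod int p = i mod int p" for i
    using assms div_mult_self2[of "int p" i "- t"] mod_mult_self2[of i "int p" "- t"] by simp_all
  then show ?thesis
    unfolding regroup_def shift_config by (intro config_cong) (simp add: shift_def)
qed

lemma regroup_bij:
  assumes p: "p > 0"
  shows "bij_betw (regroup p n) (carrier (lamps p (p * n))) (carrier (lamps p n))"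
proof (rule bij_betw_byWitness)
  \<comment> \<open>The inverse map: lamp \<open>j\<close> of a block belongs to the residue
    \<open>j div n\<close> and the coordinate \<open>j mod n\<close>.\<close>
  define u where "u g = config p (p * n) (\<lambda>i j. g (int p * i + int (j div n)) (j mod n))" for g
  have quot: "j div n < p" if "j < p * n" for j
    using that by (simp add: less_mult_imp_div_less)
  show "\<forall>f\<in>carrier (lamps p (p * n)). u (regroup p n f) = f"
  proof
    fix f assume f: "f \<in> carrier (lamps p (p * n))"
    have "u (regroup p n f) = config p (p * n) f"
      unfolding u_def
    proof (rule config_cong)
      fix i j assume j: "j < p * n"
      \<comment> \<open>The existence of some \<open>j < p * n\<close> excludes
        \<open>n = 0\<close>, so \<open>j mod n\<close> is a coordinate below
        \<open>n\<close>.\<close>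
      then have "n > 0" by (cases n) auto
      then show "regroup p n f (int p * i + int (j div n)) (j mod n) mod int p = f i j mod int p"
        using p quot[OF j] by (simp add: regroup_def config_def)
    qed
    then show "u (regroup p n f) = f" using config_eq[OF p f] by simp
  qed
  show "\<forall>g\<in>carrier (lamps p n). regroup p n (u g) = g"
  proof
    fix g assume g: "g \<in> carrier (lamps p n)"
    have "regroup p n (u g) = config p n g"
      unfolding u_def regroup_config[OF p] unfolding regroup_def
      by (rule config_cong) (use p in simp)
    then show "regroup p n (u g) = g" using config_eq[OF p g] by simp
  qed
  show "regroup p n ` carrier (lamps p (p * n)) \<subseteq> carrier (lamps p n)"
    using regroup_hom[OF p] by (auto simp: hom_def)
  show "u ` carrier (lamps p n) \<subseteq> carrier (lamps p (p * n))"
  proof (rule image_subsetI)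
    fix g assume g: "g \<in> carrier (lamps p n)"
    let ?S = "{i. \<exists>j<n. g i j \<noteq> 0}"
    show "u g \<in> carrier (lamps p (p * n))"
      unfolding u_def
    proof (rule config_in_lamps[OF p], rule finite_subset)
      show "finite ((\<lambda>i. i div int p) ` ?S)"
        using g carrier_lamps[OF p, of g n] by blast
      show "{i. \<exists>j<p * n. g (int p * i + int (j div n)) (j mod n) mod int p \<noteq> 0}
          \<subseteq> (\<lambda>i. i div int p) ` ?S"
      proof
        fix i assume "i \<in> {i. \<exists>j<p * n. g (int p * i + int (j div n)) (j mod n) mod int p \<noteq> 0}"
        then obtain j where j: "j < p * n" "g (int p * i + int (j div n)) (j mod n) \<noteq> 0" by force
        then have "n > 0" by (cases n) auto
        then have "int p * i + int (j div n) \<in> ?S"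
          using j by (intro CollectI exI[of _ "j mod n"]) simp
        moreover have "i = (int p * i + int (j div n)) div int p" using p quot[OF j(1)] by simp
        ultimately show "i \<in> (\<lambda>i. i div int p) ` ?S" by blast
      qed
    qed
  qed
qed

subsection \<open>Subgroups of index \<open>p\<close>\<close>

text \<open>As \<open>H\<close> contains the base, membership in \<open>H\<close> depends only on
  the integer component. This makes \<open>H\<close> normal and reduces everything to powers of
  \<open>x = (\<one>, 1)\<close>; the base part of \<open>H\<close> is the whole base, the image of
  \<open>regroup\<close>.\<close>

lemma lamplighter_subgroup_of_lamps_subset:
  assumes p: "Factorial_Ring.prime p" and H: "subgroup H (lamplighter p n)"
    and index: "card (rcosets\<^bsub>lamplighter p n\<^esub> H) = p"
    and V: "carrier (lamps p n) \<times> {0} \<subseteq> H"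
  shows "(lamplighter p n)\<lparr>carrier := H\<rparr> \<cong> lamplighter p (p * n)"
proof -
  let ?L = "lamplighter p n" and ?V = "lamps p n"
  have p0: "p > 0" using p prime_gt_0_nat by simp
  interpret L: group ?L by (rule group_lamplighter)
  interpret V: group ?V by (rule group_lamps)
  define x where "x = (\<one>\<^bsub>?V\<^esub>, 1::int)"
  have x: "x \<in> carrier ?L" by (simp add: x_def carrier_lamplighter)
  have snd_x_pow: "snd (x [^]\<^bsub>?L\<^esub> (t::int)) = t" for t
    using snd_int_pow_lamplighter[OF x, of t] by (simp add: x_def)
  \<comment> \<open>\<open>y\<close> times the inverse of \<open>z\<close> has integer component 0,
    so it lies in the base.\<close>
  have mem_snd: "y \<in> H" if y: "y \<in> carrier ?L" and z: "z \<in> H" and "snd y = snd z" for y z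
  proof -
    have zL: "z \<in> carrier ?L" using subgroup.subset[OF H] z by auto
    have "snd (y \<otimes>\<^bsub>?L\<^esub> z [^]\<^bsub>?L\<^esub> (- 1 :: int)) = 0"
      using hom_mult[OF snd_hom_lamplighter y L.int_pow_closed[OF zL]]
        snd_int_pow_lamplighter[OF zL, of "- 1"] \<open>snd y = snd z\<close> by simp
    moreover have c: "y \<otimes>\<^bsub>?L\<^esub> z [^]\<^bsub>?L\<^esub> (- 1 :: int) \<in> carrier ?L"
      using y zL by simp
    ultimately have "y \<otimes>\<^bsub>?L\<^esub> z [^]\<^bsub>?L\<^esub> (- 1 :: int) \<in> H"
      using V by (force simp: carrier_lamplighter)
    then have "(y \<otimes>\<^bsub>?L\<^esub> z [^]\<^bsub>?L\<^esub> (- 1 :: int)) \<otimes>\<^bsub>?L\<^esub> z \<in> H"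
      using subgroup.m_closed[OF H] z by blast
    then show ?thesis using y zL by (simp add: L.m_assoc L.int_pow_neg L.int_pow_1)
  qed
  have normal: "H \<lhd> ?L"
    unfolding L.normal_inv_iff
  proof (intro conjI ballI)
    fix y h assume "y \<in> carrier ?L" "h \<in> H"
    moreover have "h \<in> carrier ?L" using subgroup.subset[OF H] \<open>h \<in> H\<close> by auto
    moreover have "snd (inv\<^bsub>?L\<^esub> y) = - snd y"
      using snd_int_pow_lamplighter[OF \<open>y \<in> carrier ?L\<close>, of "- 1"] \<open>y \<in> carrier ?L\<close>
      by (simp add: L.int_pow_neg L.int_pow_1)
    ultimately show "y \<otimes>\<^bsub>?L\<^esub> h \<otimes>\<^bsub>?L\<^esub> inv\<^bsub>?L\<^esub> y \<in> H"
      using mem_snd[of _ h] hom_mult[OF snd_hom_lamplighter] by simp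
  qed (rule H)
  have xp: "x [^]\<^bsub>?L\<^esub> int p \<in> H"
    using L.pow_card_rcosets_mem_normal[OF normal x] index by (simp add: int_pow_int)
  have "x \<notin> H"
  proof
    assume xH: "x \<in> H"
    have "y \<in> H" if "y \<in> carrier ?L" for y
      using mem_snd[OF that L.subgroup_int_pow_closed[OF H xH, of "snd y"]] snd_x_pow[of "snd y"]
      by simp
    then have "H #>\<^bsub>?L\<^esub> y = H" if "y \<in> carrier ?L" for y
      using L.coset_join2[OF that H] that by blast
    then have "rcosets\<^bsub>?L\<^esub> H \<subseteq> {H}" by (auto simp: RCOSETS_def)
    then have "card (rcosets\<^bsub>?L\<^esub> H) \<le> 1" using card_mono[of "{H}"] by simp
    then show False using index p prime_gt_1_nat[of p] by simp
  qed
  \<comment> \<open>Were \<open>t\<close> prime to \<open>p\<close>, then \<open>x^t\<close> and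
    \<open>x^p\<close> in \<open>H\<close> would give \<open>x\<close> in \<open>H\<close>.\<close>
  have dvd: "int p dvd t" if "(f, t) \<in> H" for f t
  proof (rule ccontr)
    assume "\<not> int p dvd t"
    then have "coprime (int p) t"
      using p prime_imp_coprime[of "int p" t] by (metis prime_nat_int_transfer)
    moreover have "x [^]\<^bsub>?L\<^esub> t \<in> H"
      using mem_snd[OF L.int_pow_closed[OF x, of t] that] snd_x_pow[of t] by simp
    ultimately show False
      using L.mem_subgroup_of_coprime_pows[OF H x xp, of t] \<open>x \<notin> H\<close> by blast
  qed
  obtain v where v: "(v, int p) \<in> H" using xp snd_x_pow[of "int p"] by (cases "x [^]\<^bsub>?L\<^esub> int p") simp
  show ?thesis
  proof (rule iso_lamplighter_of_equivariant[OF p0 H regroup_hom[OF p0] _ _ _ v])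
    show "{f \<in> carrier ?V. (f, 0) \<in> H} = regroup p n ` carrier (lamps p (p * n))"
      using V regroup_bij[OF p0, of n] by (auto simp: bij_betw_def)
  qed (use regroup_bij[OF p0] regroup_shift[OF p0] p0 dvd in \<open>auto simp: bij_betw_def\<close>)
qed

lemma lamplighter_subgroup_of_not_lamps_subset:
  assumes p: "Factorial_Ring.prime p" and H: "subgroup H (lamplighter p n)"
    and index: "card (rcosets\<^bsub>lamplighter p n\<^esub> H) = p"
    and V: "\<not> carrier (lamps p n) \<times> {0} \<subseteq> H"
  shows "(lamplighter p n)\<lparr>carrier := H\<rparr> \<cong> lamplighter p n"
proof -
  let ?L = "lamplighter p n" and ?V = "lamps p n"
  have p0: "p > 0" using p prime_gt_0_nat by simp
  interpret L: group ?L by (rule group_lamplighter)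
  interpret V: group ?V by (rule group_lamps)
  have emb: "group_hom ?V ?L (\<lambda>f. (f, 0))"
    by (intro group_hom.intro group_hom_axioms.intro group_lamps group_lamplighter lamps_embedding_hom)
  define W where "W = {f \<in> carrier ?V. (f, 0) \<in> H}"
  have W: "subgroup W ?V"
  proof (rule V.subgroupI)
    show "W \<noteq> {}" using subgroup.one_closed[OF H] by (auto simp: W_def one_lamplighter)
  next
    fix f assume "f \<in> W"
    then show "inv\<^bsub>?V\<^esub> f \<in> W"
      using subgroup.m_inv_closed[OF H, of "(f, 0)"] group_hom.hom_inv[OF emb, of f]
      by (auto simp: W_def)
  next
    fix f g assume "f \<in> W" "g \<in> W"
    then show "f \<otimes>\<^bsub>?V\<^esub> g \<in> W"
      using subgroup.m_closed[OF H, of "(f, 0)" "(g, 0)"]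
      by (auto simp: W_def mult_lamplighter)
  qed (auto simp: W_def)
  have L: "lamp p n i j c \<in> carrier ?V" for i j c by (rule lamp_in_lamps[OF p0])
  \<comment> \<open>A monomial has order dividing \<open>p\<close>, so if it lies outside
    \<open>W\<close> its powers represent all cosets of \<open>H\<close>.\<close>
  have transversal: "\<exists>c. y \<otimes>\<^bsub>?L\<^esub> (lamp p n i k (- c), 0) \<in> H"
    if "lamp p n i k 1 \<notin> W" and y: "y \<in> carrier ?L" for i k y
  proof -
    let ?x = "(lamp p n i k 1, 0::int)"
    have pow: "?x [^]\<^bsub>?L\<^esub> c = (lamp p n i k (int c), 0)" for c :: nat
      using group_hom.hom_nat_pow[OF emb L, of i k 1 c] lamp_int_pow[OF p0, of n i k "int c"]
      by (simp add: int_pow_int)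
    have "?x [^]\<^bsub>?L\<^esub> p \<in> H"
      using subgroup.one_closed[OF H] by (simp add: pow lamp_eq_one one_lamplighter)
    moreover have "?x \<in> carrier ?L" "?x \<notin> H"
      using L that by (auto simp: W_def carrier_lamplighter)
    ultimately obtain c where "y \<otimes>\<^bsub>?L\<^esub> inv\<^bsub>?L\<^esub> (?x [^]\<^bsub>?L\<^esub> (c::nat)) \<in> H"
      using L.pow_transversal_of_prime_index[OF H index p _ _ _ y] by blast
    then show ?thesis
      using group_hom.hom_inv[OF emb L, of i k "int c"]
      by (auto simp: pow inv_lamp[OF p0] intro!: exI[of _ "int c"])
  qed
  have "\<exists>i k. k < n \<and> lamp p n i k 1 \<notin> W"
  proof (rule ccontr)
    assume "\<not> ?thesis"
    then have lamp: "lamp p n i k 1 \<in> W" if "k < n" for i k using that by blast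
    have "f \<in> W" if "f \<in> carrier ?V" for f
      using p0 that
      by (induction rule: lamps_induct)
        (simp_all add: lamp subgroup.one_closed[OF W] subgroup.m_closed[OF W])
    then show False using V by (auto simp: W_def)
  qed
  then obtain i k where k: "k < n" and ik: "lamp p n i k 1 \<notin> W" by blast
  \<comment> \<open>Correcting the generator of the integers by a lamp keeps its integer component 1
    and brings it into \<open>H\<close>.\<close>
  have "(\<one>\<^bsub>?V\<^esub>, 1) \<in> carrier ?L" by (simp add: carrier_lamplighter)
  then obtain v where v: "(v, 1) \<in> H"
    using transversal[OF ik] by (fastforce simp: mult_lamplighter)
  have vL: "(v, 1) \<in> carrier ?L" using v subgroup.subset[OF H] by blast
  \<comment> \<open>Conjugation by the \<open>t\<close>-th power of \<open>(v, 1)\<close> preserves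
    \<open>H\<close> and shifts the base by \<open>t\<close>.\<close>
  have shift: "shift t f \<in> W" if f: "f \<in> W" for f t
  proof -
    let ?y = "(v, 1) [^]\<^bsub>?L\<^esub> t"
    have fV: "f \<in> carrier ?V" "(f, 0) \<in> H" using f by (auto simp: W_def)
    have sV: "shift t f \<in> carrier ?V" using shift_in_lamps[OF p0 fV(1)] .
    have yH: "?y \<in> H" by (rule L.subgroup_int_pow_closed[OF H v])
    have yL: "?y \<in> carrier ?L" using vL by simp
    have fL: "(f, 0) \<in> carrier ?L" "(shift t f, 0) \<in> carrier ?L"
      using fV(1) sV by (simp_all add: carrier_lamplighter)
    have "(shift t f, 0) \<otimes>\<^bsub>?L\<^esub> ?y = ?y \<otimes>\<^bsub>?L\<^esub> (f, 0)"
      using conj_lamplighter[OF p0 yL fV(1)] snd_int_pow_lamplighter[OF vL, of t] by simp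
    then have "(shift t f, 0) = ?y \<otimes>\<^bsub>?L\<^esub> (f, 0) \<otimes>\<^bsub>?L\<^esub> inv\<^bsub>?L\<^esub> ?y"
      using L.inv_solve_right[of "(shift t f, 0)" "?y \<otimes>\<^bsub>?L\<^esub> (f, 0)" ?y] yL fL by simp
    also have "\<dots> \<in> H"
      by (intro subgroup.m_closed[OF H] subgroup.m_inv_closed[OF H] yH fV)
    finally show ?thesis using sV by (simp add: W_def)
  qed
  \<comment> \<open>By shift invariance the monomial outside \<open>W\<close> can be moved to
    position 0, as \<open>image_twist\<close> requires.\<close>
  have notin: "lamp p n 0 k 1 \<notin> W"
    using ik shift[of "lamp p n 0 k 1" i] by (auto simp: shift_lamp)
  have "\<exists>c. f \<otimes>\<^bsub>?V\<^esub> lamp p n 0 k (- c) \<in> W" if "f \<in> carrier ?V" for f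
    using transversal[OF notin, of "(f, 0)"] that L
    by (auto simp: W_def carrier_lamplighter mult_lamplighter)
  \<comment> \<open>The scalars \<open>d l\<close> express \<open>x e_k\<close> and the other
    \<open>e_l\<close> modulo \<open>W\<close> as multiples of \<open>e_k\<close>.\<close>
  then have "\<exists>c. (if l = k then lamp p n 1 k 1 else lamp p n 0 l 1) \<otimes>\<^bsub>?V\<^esub> lamp p n 0 k (- c) \<in> W" for l
    using L by simp
  then obtain d where d: "(if l = k then lamp p n 1 k 1 else lamp p n 0 l 1) \<otimes>\<^bsub>?V\<^esub> lamp p n 0 k (- d l) \<in> W" for l
    by metis
  show ?thesis
  proof (rule iso_lamplighter_of_equivariant[OF p0 H twist_hom[OF p0 k] twist_inj[OF p0 k] _ _ v])
    show "{f \<in> carrier ?V. (f, 0) \<in> H} = twist p n k d ` carrier ?V"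
      using image_twist[OF p k W shift notin d] by (simp add: W_def)
  qed (simp_all add: twist_shift)
qed

theorem corollary3p7:
  fixes p n :: nat and H :: "((int \<Rightarrow> nat \<Rightarrow> int) \<times> int) set"
  assumes "Factorial_Ring.prime p" and "n \<ge> 1"
    and "subgroup H (lamplighter p n)"
    and "card (rcosets\<^bsub>lamplighter p n\<^esub> H) = p"
  shows "(lamplighter p n)\<lparr>carrier := H\<rparr> \<cong> lamplighter p n \<or>
         (lamplighter p n)\<lparr>carrier := H\<rparr> \<cong> lamplighter p (p * n)"
  using lamplighter_subgroup_of_lamps_subset[OF assms(1,3,4)]
    lamplighter_subgroup_of_not_lamps_subset[OF assms(1,3,4)] by blast

end
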